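(* Let $k$ be a positive integer and let $G$ be a bridgeless cyclically $k$-edge-connected cubic graph. If $k \geq 5\mu_2(G) - 3$, then $G$ has a nowhere-zero 5-flow.
   Context: A cubic graph is a graph all of whose vertices have degree 3 (graphs are finite). A graph is cyclically $k$-edge-connected if it has no edge cut $E$ with fewer than $k$ edges such that two components of $G-E$ contain circuits. A 1-factor of $G$ is a perfect matching, regarded as a set of edges. For a bridgeless cubic graph $G$, $\mu_2(G) = \min\{|M_1 \cap M_2| : M_1 \text{ and } M_2 \text{ are 1-factors of } G\}$ (1-factors exist by Petersen's theorem). A nowhere-zero $k$-flow on $G$ is an assignment of a direction and a value from $\{1,\dots,k-1\}$ to each edge of $G$ such that Kirchhoff's law holds at every vertex (the sum of the values on incoming edges equals the sum of the values on outgoing edges). *)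

theory Defs
  imports Main "HOL-Library.Multiset" "HOL-Library.Extended_Nat"
begin

text \<open>
  Finite undirected graphs, with parallel edges and loops permitted. The multiset of ends of an
  edge has two elements, \<open>{#u, v#}\<close>; a loop at \<open>v\<close> has ends \<open>{#v, v#}\<close>, so that it contributes
  2 to the degree of \<open>v\<close>.
\<close>

record ('v, 'e) ugraph =
  verts :: "'v set"
  edges :: "'e set"
  ends :: "'e \<Rightarrow> 'v multiset"

definition finite_graph :: "('v, 'e) ugraph \<Rightarrow> bool" where
  "finite_graph G \<longleftrightarrow>
     finite (verts G) \<and> finite (edges G) \<and>
     (\<forall>e \<in> edges G. size (ends G e) = 2 \<and> set_mset (ends G e) \<subseteq> verts G)"

definition degree :: "('v, 'e) ugraph \<Rightarrow> 'v \<Rightarrow> nat" where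
  "degree G v = (\<Sum>e\<in>edges G. count (ends G e) v)"

definition regular :: "nat \<Rightarrow> ('v, 'e) ugraph \<Rightarrow> bool" where
  "regular r G \<longleftrightarrow> (\<forall>v \<in> verts G. degree G v = r)"

definition cubic :: "('v, 'e) ugraph \<Rightarrow> bool" where
  "cubic G \<longleftrightarrow> regular 3 G"

definition subgraph :: "('v, 'e) ugraph \<Rightarrow> ('v, 'e) ugraph \<Rightarrow> bool" where
  "subgraph H G \<longleftrightarrow>
     finite_graph H \<and> verts H \<subseteq> verts G \<and> edges H \<subseteq> edges G \<and>
     (\<forall>e \<in> edges H. ends H e = ends G e)"

definition delete_edges :: "('v, 'e) ugraph \<Rightarrow> 'e set \<Rightarrow> ('v, 'e) ugraph" where
  "delete_edges G F = G\<lparr>edges := edges G - F\<rparr>"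

definition induced_subgraph :: "('v, 'e) ugraph \<Rightarrow> 'v set \<Rightarrow> ('v, 'e) ugraph" where
  "induced_subgraph G X =
     G\<lparr>verts := X, edges := {e \<in> edges G. set_mset (ends G e) \<subseteq> X}\<rparr>"

definition adjacent :: "('v, 'e) ugraph \<Rightarrow> 'v \<Rightarrow> 'v \<Rightarrow> bool" where
  "adjacent G u v \<longleftrightarrow> (\<exists>e \<in> edges G. ends G e = {#u, v#})"

definition connected_graph :: "('v, 'e) ugraph \<Rightarrow> bool" where
  "connected_graph G \<longleftrightarrow>
     verts G \<noteq> {} \<and> (\<forall>u \<in> verts G. \<forall>v \<in> verts G. (adjacent G)\<^sup>*\<^sup>* u v)"

definition components :: "('v, 'e) ugraph \<Rightarrow> ('v, 'e) ugraph set" where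
  "components G =
     (\<lambda>u. induced_subgraph G {v \<in> verts G. (adjacent G)\<^sup>*\<^sup>* u v}) ` verts G"

definition bridgeless :: "('v, 'e) ugraph \<Rightarrow> bool" where
  "bridgeless G \<longleftrightarrow>
     \<not> (\<exists>e \<in> edges G. card (components (delete_edges G {e})) > card (components G))"

definition circuit :: "('v, 'e) ugraph \<Rightarrow> bool" where
  "circuit C \<longleftrightarrow> finite_graph C \<and> connected_graph C \<and> regular 2 C"

definition contains_circuit :: "('v, 'e) ugraph \<Rightarrow> bool" where
  "contains_circuit G \<longleftrightarrow> (\<exists>C. subgraph C G \<and> circuit C)"

definition edge_cut :: "('v, 'e) ugraph \<Rightarrow> 'e set \<Rightarrow> bool" where
  "edge_cut G F \<longleftrightarrow>
     (\<exists>X. X \<noteq> {} \<and> X \<subset> verts G \<and>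
        F = {e \<in> edges G. \<exists>u \<in> X. \<exists>v \<in> verts G - X. ends G e = {#u, v#}})"

definition cyclically_edge_connected :: "nat \<Rightarrow> ('v, 'e) ugraph \<Rightarrow> bool" where
  "cyclically_edge_connected k G \<longleftrightarrow>
     \<not> (\<exists>F. edge_cut G F \<and> card F < k \<and>
          (\<exists>C \<in> components (delete_edges G F). \<exists>D \<in> components (delete_edges G F).
             C \<noteq> D \<and> contains_circuit C \<and> contains_circuit D))"

text \<open>A 1-factor is the edge set of a spanning 1-regular subgraph.\<close>

definition one_factor :: "('v, 'e) ugraph \<Rightarrow> 'e set \<Rightarrow> bool" where
  "one_factor G M \<longleftrightarrow> M \<subseteq> edges G \<and> regular 1 (G\<lparr>edges := M\<rparr>)"

text \<open>
  The infimum is taken in the extended naturals. It is a minimum, and finite, if \<open>G\<close> has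
  a 1-factor, which by Petersen's theorem is the case for every bridgeless cubic graph; it is
  \<open>\<infinity>\<close> for graphs without 1-factors.
\<close>

definition mu2 :: "('v, 'e) ugraph \<Rightarrow> enat" where
  "mu2 G = Inf {enat (card (M1 \<inter> M2)) | M1 M2. one_factor G M1 \<and> one_factor G M2}"

text \<open>The direction of an edge is given by its tail \<open>t e\<close> and its head \<open>h e\<close>.\<close>

definition has_nowhere_zero_flow :: "nat \<Rightarrow> ('v, 'e) ugraph \<Rightarrow> bool" where
  "has_nowhere_zero_flow k G \<longleftrightarrow>
     (\<exists>(t :: 'e \<Rightarrow> 'v) (h :: 'e \<Rightarrow> 'v) (f :: 'e \<Rightarrow> nat).
        (\<forall>e \<in> edges G. ends G e = {#t e, h e#} \<and> f e \<in> {1..k - 1}) \<and>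
        (\<forall>v \<in> verts G.
           (\<Sum>e | e \<in> edges G \<and> h e = v. f e) = (\<Sum>e | e \<in> edges G \<and> t e = v. f e)))"

end

theory Submission imports Defs begin

text \<open>
  Let \<open>M1\<close>, \<open>M2\<close> be 1-factors meeting in \<open>g = mu2 G\<close> edges, and let \<open>F\<close> be the 2-factor complementary
  to \<open>M1\<close>. A maximum matching \<open>M\<close> of \<open>F\<close> leaves at most one vertex in each circuit of \<open>F\<close> unmatched,
  and at most \<open>2g\<close> altogether, because \<open>M2 - M1\<close> leaves \<open>2g\<close>; let \<open>T\<close> be the set of these vertices.
  The graph \<open>M1 \<union> M\<close> is bipartite. For a colouring \<open>w\<close> of its vertices by \<open>1\<close> and \<open>-1\<close> and a set \<open>X\<close>
  of vertices, \<open>|w(X)|\<close> is at most the number of \<open>M1\<close>-edges leaving \<open>X\<close>, and at most the number of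
  \<open>M\<close>-edges leaving \<open>X\<close> plus \<open>|w(X \<inter> T)|\<close>.

  By Jaeger's criterion a nowhere-zero 5-flow exists if \<open>5 |w(X)| \<le> 3 n\<close> for every \<open>X\<close>, where \<open>n\<close> is the
  number of edges leaving \<open>X\<close>. If no circuit of \<open>F\<close> through \<open>T\<close> lies in \<open>X\<close>, then at least two edges
  of \<open>F\<close> leave \<open>X\<close> for each vertex of \<open>X \<inter> T\<close>, and the bound follows; likewise for the complement of
  \<open>X\<close>. Otherwise the cut separates two circuits, so \<open>n \<ge> 5g - 3\<close>. Since \<open>T\<close> is balanced,
  \<open>|w(X \<inter> T)| \<le> g\<close>, hence \<open>2 |w(X)| \<le> n + g\<close>, and as \<open>w(X)\<close> and \<open>n\<close> have the same parity this
  again gives the bound.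
\<close>

section \<open>Circulations\<close>

locale multigraph =
  fixes V :: "'v set" and E :: "'e set" and t h :: "'e \<Rightarrow> 'v"
  assumes finite_V: "finite V" and finite_E: "finite E"
    and tail_in_V: "e \<in> E \<Longrightarrow> t e \<in> V" and head_in_V: "e \<in> E \<Longrightarrow> h e \<in> V"
begin

definition net :: "('e \<Rightarrow> int) \<Rightarrow> 'v \<Rightarrow> int" where
  "net f v = (\<Sum>e\<in>E. f e * (of_bool (t e = v) - of_bool (h e = v)))"

definition residual :: "('e \<Rightarrow> int) \<Rightarrow> ('e \<Rightarrow> int) \<Rightarrow> ('e \<Rightarrow> int) \<Rightarrow> 'v \<Rightarrow> 'v \<Rightarrow> bool" where
  "residual l u f x y \<longleftrightarrow> (\<exists>e\<in>E. t e = x \<and> h e = y \<and> f e < u e \<or> h e = x \<and> t e = y \<and> l e < f e)"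

definition feasible :: "('e \<Rightarrow> int) \<Rightarrow> ('e \<Rightarrow> int) \<Rightarrow> ('e \<Rightarrow> int) \<Rightarrow> bool" where
  "feasible l u f \<longleftrightarrow> (\<forall>e\<in>E. l e \<le> f e \<and> f e \<le> u e)"

lemma net_sum:
  assumes "finite X"
  shows "(\<Sum>v\<in>X. net f v) = (\<Sum>e\<in>E. f e * (of_bool (t e \<in> X) - of_bool (h e \<in> X)))"
proof -
  have "(\<Sum>v\<in>X. net f v) = (\<Sum>e\<in>E. \<Sum>v\<in>X. f e * (of_bool (t e = v) - of_bool (h e = v)))"
    unfolding net_def by (rule sum.swap)
  also have "\<dots> = (\<Sum>e\<in>E. f e * (of_bool (t e \<in> X) - of_bool (h e \<in> X)))"
    using assms by (intro sum.cong refl)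
      (auto simp: sum_distrib_left[symmetric] sum_subtractf of_bool_def)
  finally show ?thesis .
qed

lemma net_sum_V: "(\<Sum>v\<in>V. net f v) = 0"
  by (simp add: net_sum[OF finite_V] tail_in_V head_in_V)

lemma net_update:
  assumes "e \<in> E"
  shows "net (f(e := f e + c)) v = net f v + c * (of_bool (t e = v) - of_bool (h e = v))"
proof -
  have "net (f(e := f e + c)) v =
      (\<Sum>e'\<in>E. f e' * (of_bool (t e' = v) - of_bool (h e' = v))
        + (if e' = e then c * (of_bool (t e = v) - of_bool (h e = v)) else 0))"
    unfolding net_def by (intro sum.cong) (auto simp: algebra_simps)
  then show ?thesis
    using assms finite_E by (simp add: sum.distrib net_def)
qed

text \<open>Recording that only one edge changes, and that its ends are \<open>x\<close> and
  \<open>y\<close>, is what allows pushes to be repeated along a walk.\<close>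

lemma residual_push:
  assumes "residual l u f x y" "feasible l u f" "x \<noteq> y"
  obtains e f' where "e \<in> E" "{t e, h e} = {x, y}" "feasible l u f'" "\<And>e'. e' \<noteq> e \<Longrightarrow> f' e' = f e'"
    "\<And>v. net f' v = net f v + of_bool (v = x) - of_bool (v = y)"
proof -
  from assms(1) obtain e where e: "e \<in> E"
    "t e = x \<and> h e = y \<and> f e < u e \<or> h e = x \<and> t e = y \<and> l e < f e"
    unfolding residual_def by blast
  define c :: int where "c = (if t e = x then 1 else -1)"
  show ?thesis
  proof
    show "e \<in> E" "{t e, h e} = {x, y}" using e by auto
    show "feasible l u (f(e := f e + c))"
      using e assms(2,3) unfolding feasible_def c_def by auto
    show "net (f(e := f e + c)) v = net f v + of_bool (v = x) - of_bool (v = y)" for v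
      using e assms(3) unfolding net_update[OF e(1)] c_def by auto
  qed auto
qed

text \<open>The unit is pushed along the last arc first. Since \<open>p (Suc n)\<close> occurs
  nowhere else on the injective walk, no earlier arc uses the altered edge, so the earlier arcs stay
  residual.\<close>

lemma residual_push_walk:
  assumes "feasible l u f" "inj_on p {..n}" "\<And>i. i < n \<Longrightarrow> residual l u f (p i) (p (Suc i))"
  shows "\<exists>f'. feasible l u f' \<and> (\<forall>v. net f' v = net f v + of_bool (v = p 0) - of_bool (v = p n))"
  using assms
proof (induction n arbitrary: f)
  case 0
  then show ?case by auto
next
  case (Suc n)
  have "p n \<noteq> p (Suc n)" using Suc.prems(2) by (auto dest: inj_onD)
  with Suc.prems obtain e f1 where f1: "{t e, h e} = {p n, p (Suc n)}" "feasible l u f1"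
    "\<And>e'. e' \<noteq> e \<Longrightarrow> f1 e' = f e'"
    "\<And>v. net f1 v = net f v + of_bool (v = p n) - of_bool (v = p (Suc n))"
    using residual_push[of l u f "p n" "p (Suc n)"] by (metis lessI)
  have "residual l u f1 (p i) (p (Suc i))" if "i < n" for i
  proof -
    have "p (Suc n) \<noteq> p i" "p (Suc n) \<noteq> p (Suc i)"
      using Suc.prems(2) that by (auto dest: inj_onD)
    then have "{p i, p (Suc i)} \<noteq> {t e, h e}" unfolding f1(1) by auto
    then have "t e' = p i \<and> h e' = p (Suc i) \<or> h e' = p i \<and> t e' = p (Suc i) \<Longrightarrow> f1 e' = f e'" for e'
      using f1(3) by (metis doubleton_eq_iff)
    then show ?thesis
      using Suc.prems(3)[of i] that unfolding residual_def by (metis less_Suc_eq)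
  qed
  moreover have "inj_on p {..n}" using Suc.prems(2) by (rule inj_on_subset) auto
  ultimately obtain f' where "feasible l u f'"
    "\<forall>v. net f' v = net f1 v + of_bool (v = p 0) - of_bool (v = p n)"
    using Suc.IH f1(2) by blast
  then show ?case using f1(4) by (intro exI[of _ f']) auto
qed

end

lemma relpowp_segment:
  assumes "\<And>k. i \<le> k \<Longrightarrow> k < j \<Longrightarrow> R (p k) (p (Suc k))" "i \<le> j"
  shows "(R ^^ (j - i)) (p i) (p j)"
  unfolding relpowp_fun_conv
  by (intro exI[of _ "\<lambda>k. p (i + k)"]) (use assms in auto)

text \<open>A shortest walk is injective, because the part between two visits to the same point
  could be cut out.\<close>

lemma rtranclp_imp_inj_walk:
  assumes "R\<^sup>*\<^sup>* x y"
  obtains p n where "p 0 = x" "p n = y" "inj_on p {..n}" "\<And>i. i < n \<Longrightarrow> R (p i) (p (Suc i))"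
proof -
  define n where "n = (LEAST n. (R ^^ n) x y)"
  have ex: "\<exists>n. (R ^^ n) x y" using assms by (simp add: rtranclp_power)
  then have n: "(R ^^ n) x y" unfolding n_def by (rule LeastI_ex)
  have least: "\<not> (R ^^ m) x y" if "m < n" for m
    using that unfolding n_def by (rule not_less_Least)
  from n obtain p where p: "p 0 = x" "p n = y" "\<And>i. i < n \<Longrightarrow> R (p i) (p (Suc i))"
    unfolding relpowp_fun_conv by auto
  have ne: "p i \<noteq> p j" if "i < j" "j \<le> n" for i j
  proof
    assume eq: "p i = p j"
    have "(R ^^ (i - 0)) (p 0) (p i)" using p(3) that by (intro relpowp_segment) auto
    moreover have "(R ^^ (n - j)) (p j) (p n)" using p(3) that by (intro relpowp_segment) auto
    ultimately have "(R ^^ (i + (n - j))) x y"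
      using p(1,2) eq unfolding relpowp_add by auto
    moreover have "i + (n - j) < n" using that by linarith
    ultimately show False using least by blast
  qed
  then have "inj_on p {..n}"
    by (intro inj_onI) (metis atMost_iff linorder_neqE_nat)
  with p show ?thesis using that by blast
qed

context multigraph
begin

text \<open>A feasible \<open>f\<close> closest to the demand \<open>b\<close> meets it, since otherwise the vertices reachable in the
  residual graph from a vertex with too little outflow violate the cut condition.\<close>

theorem hoffman:
  fixes b :: "'v \<Rightarrow> int"
  assumes lu: "\<And>e. e \<in> E \<Longrightarrow> l e \<le> u e" and b0: "(\<Sum>v\<in>V. b v) = 0"
    and cut: "\<And>X. X \<subseteq> V \<Longrightarrow> (\<Sum>v\<in>X. b v) \<le>
      (\<Sum>e | e \<in> E \<and> t e \<in> X \<and> h e \<notin> X. u e) - (\<Sum>e | e \<in> E \<and> t e \<notin> X \<and> h e \<in> X. l e)"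
  shows "\<exists>f. feasible l u f \<and> (\<forall>v\<in>V. net f v = b v)"
proof -
  \<comment> \<open>Being a natural number, the total deviation from the demand attains its minimum
    over the feasible functions.\<close>
  define \<mu> where "\<mu> f = nat (\<Sum>v\<in>V. \<bar>net f v - b v\<bar>)" for f
  have "feasible l u l" using lu by (auto simp: feasible_def)
  then obtain f where f: "feasible l u f" and fmin: "\<And>g. feasible l u g \<Longrightarrow> \<mu> f \<le> \<mu> g"
    using ex_has_least_nat[of "feasible l u" l \<mu>] by blast
  have "\<forall>v\<in>V. net f v = b v"
  proof (rule ccontr)
    assume "\<not> ?thesis"
    then obtain z where z: "z \<in> V" "net f z \<noteq> b z" by auto
    have sum0: "(\<Sum>v\<in>V. net f v - b v) = 0" by (simp add: sum_subtractf net_sum_V b0)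
    have "\<exists>x\<in>V. net f x < b x"
    proof (rule ccontr)
      assume "\<not> ?thesis"
      then have "\<forall>v\<in>V. 0 \<le> net f v - b v" by auto
      then have "\<forall>v\<in>V. net f v - b v = 0"
        using sum_nonneg_eq_0_iff[OF finite_V, of "\<lambda>v. net f v - b v"] sum0 by blast
      then show False using z by auto
    qed
    then obtain x where x: "x \<in> V" "net f x < b x" by blast
    define R where "R = {y \<in> V. (residual l u f)\<^sup>*\<^sup>* x y}"
    have RV: "R \<subseteq> V" and finR: "finite R" and xR: "x \<in> R" using finite_V x by (auto simp: R_def)
    have le: "net f y \<le> b y" if "y \<in> R" for y
    proof (rule ccontr)
      assume gt: "\<not> net f y \<le> b y"
      have "(residual l u f)\<^sup>*\<^sup>* x y" "y \<in> V" using that by (auto simp: R_def)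
      then obtain g where g: "feasible l u g"
        "\<forall>v. net g v = net f v + of_bool (v = x) - of_bool (v = y)"
        by (elim rtranclp_imp_inj_walk) (use residual_push_walk[OF f] in blast)
      \<comment> \<open>The push from \<open>x\<close> to \<open>y\<close> lowers the deviation at
        both ends, since \<open>x\<close> has too little outflow and \<open>y\<close> too
        much.\<close>
      have "(\<Sum>v\<in>V. \<bar>net g v - b v\<bar>) < (\<Sum>v\<in>V. \<bar>net f v - b v\<bar>)"
        using g(2) x gt finite_V by (intro sum_strict_mono_ex1) auto
      moreover have "0 \<le> (\<Sum>v\<in>V. \<bar>net g v - b v\<bar>)" by (simp add: sum_nonneg)
      ultimately have "\<mu> g < \<mu> f" unfolding \<mu>_def by linarith
      then show False using fmin[OF g(1)] by simp
    qed
    have closed: "y' \<in> R" if "y \<in> R" "residual l u f y y'" for y y'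
      using that tail_in_V head_in_V unfolding R_def residual_def
      by (auto intro: rtranclp.rtrancl_into_rtrancl simp: residual_def)
    \<comment> \<open>No residual arc leaves \<open>R\<close>, so edges out of \<open>R\<close> are
      at their upper bound and edges into \<open>R\<close> at their lower bound. The net outflow of
      \<open>R\<close> is thus the right side of the cut condition.\<close>
    have "(\<Sum>e\<in>E. f e * (of_bool (t e \<in> R) - of_bool (h e \<in> R))) =
      (\<Sum>e\<in>E. (if t e \<in> R \<and> h e \<notin> R then u e else 0) - (if t e \<notin> R \<and> h e \<in> R then l e else 0))"
    proof (rule sum.cong)
      fix e assume e: "e \<in> E"
      have "f e = u e" if "t e \<in> R" "h e \<notin> R"
        using closed[OF that(1), of "h e"] that e f by (force simp: residual_def feasible_def)
      moreover have "f e = l e" if "h e \<in> R" "t e \<notin> R"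
        using closed[OF that(1), of "t e"] that e f by (force simp: residual_def feasible_def)
      ultimately show "f e * (of_bool (t e \<in> R) - of_bool (h e \<in> R)) =
        (if t e \<in> R \<and> h e \<notin> R then u e else 0) - (if t e \<notin> R \<and> h e \<in> R then l e else 0)" by auto
    qed simp
    also have "\<dots> = (\<Sum>e | e \<in> E \<and> t e \<in> R \<and> h e \<notin> R. u e) - (\<Sum>e | e \<in> E \<and> t e \<notin> R \<and> h e \<in> R. l e)"
      unfolding sum_subtractf by (simp add: sum.inter_filter[OF finite_E])
    finally have "(\<Sum>v\<in>R. b v) \<le> (\<Sum>v\<in>R. net f v)"
      using cut[OF RV] by (simp add: net_sum[OF finR])
    moreover have "(\<Sum>v\<in>R. net f v) < (\<Sum>v\<in>R. b v)"
      using le x xR finR by (intro sum_strict_mono_ex1) auto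
    ultimately show False by simp
  qed
  with f show ?thesis by blast
qed

section \<open>Orientations with prescribed net outdegrees, and flows with values from 1 to
  4\<close>

definition deg :: "'e set \<Rightarrow> 'v \<Rightarrow> nat" where
  "deg F v = (\<Sum>e\<in>F. of_bool (t e = v) + of_bool (h e = v))"

definition bd :: "'e set \<Rightarrow> 'v set \<Rightarrow> 'e set" where
  "bd F X = {e \<in> F. (t e \<in> X) \<noteq> (h e \<in> X)}"

definition adj :: "'e set \<Rightarrow> 'v \<Rightarrow> 'v \<Rightarrow> bool" where
  "adj F x y \<longleftrightarrow> (\<exists>e\<in>F. t e = x \<and> h e = y \<or> t e = y \<and> h e = x)"

lemma net_one_sum:
  assumes "finite X"
  shows "(\<Sum>v\<in>X. net (\<lambda>_. 1) v) =
    int (card {e \<in> E. t e \<in> X \<and> h e \<notin> X}) - int (card {e \<in> E. t e \<notin> X \<and> h e \<in> X})"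
proof -
  have "(\<Sum>v\<in>X. net (\<lambda>_. 1) v) =
    (\<Sum>e\<in>E. (if t e \<in> X \<and> h e \<notin> X then 1 else 0) - (if t e \<notin> X \<and> h e \<in> X then 1 else 0))"
    unfolding net_sum[OF assms] by (intro sum.cong) auto
  then show ?thesis
    unfolding sum_subtractf sum.inter_filter[OF finite_E, symmetric] by simp
qed

lemma card_bd:
  "card (bd E X) = card {e \<in> E. t e \<in> X \<and> h e \<notin> X} + card {e \<in> E. t e \<notin> X \<and> h e \<in> X}"
proof -
  have "bd E X = {e \<in> E. t e \<in> X \<and> h e \<notin> X} \<union> {e \<in> E. t e \<notin> X \<and> h e \<in> X}"
    by (auto simp: bd_def)
  then show ?thesis
    using finite_E by (simp add: card_Un_disjoint disjoint_iff)
qed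

text \<open>Keeping the edges with \<open>g e = 1\<close> and reversing those with
  \<open>g e = 0\<close> changes the net outdegree to
  \<open>2 * net g v - net (\<lambda>_. 1) v\<close>. Hence \<open>g\<close> has to meet the demand
  \<open>(w v + net (\<lambda>_. 1) v) / 2\<close>, an integer because both summands are odd when
  all degrees are 3.\<close>

lemma reorient:
  assumes w: "\<And>v. v \<in> V \<Longrightarrow> w v = 1 \<or> w v = (-1::int)"
    and deg3: "\<And>v. v \<in> V \<Longrightarrow> deg E v = 3"
    and bal: "\<And>X. X \<subseteq> V \<Longrightarrow> \<bar>\<Sum>v\<in>X. w v\<bar> \<le> int (card (bd E X))"
  obtains t' h' where "multigraph V E t' h'" "\<And>e. e \<in> E \<Longrightarrow> {#t' e, h' e#} = {#t e, h e#}"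
    "\<And>v. v \<in> V \<Longrightarrow> multigraph.net E t' h' (\<lambda>_. 1) v = w v"
proof -
  define b where "b v = (w v + net (\<lambda>_. 1) v) div 2" for v
  have b: "2 * b v = w v + net (\<lambda>_. 1) v" if "v \<in> V" for v
  proof -
    have "net (\<lambda>_. 1) v = int (deg E v) - 2 * (\<Sum>e\<in>E. of_bool (h e = v))"
      unfolding net_def deg_def by (simp add: sum.distrib sum_subtractf)
    then have "odd (net (\<lambda>_. 1) v)" using deg3[OF that] by simp
    moreover have "odd (w v)" using w[OF that] by auto
    ultimately show ?thesis unfolding b_def by simp
  qed
  have bsum: "2 * (\<Sum>v\<in>X. b v) = (\<Sum>v\<in>X. w v) + (\<Sum>v\<in>X. net (\<lambda>_. 1) v)" if "X \<subseteq> V" for X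
    using that b by (simp add: sum_distrib_left sum.distrib[symmetric] subset_iff)
  have "\<exists>g. feasible (\<lambda>_. 0) (\<lambda>_. 1) g \<and> (\<forall>v\<in>V. net g v = b v)"
  proof (rule hoffman)
    have "bd E V = {}" using tail_in_V head_in_V by (auto simp: bd_def)
    then have "(\<Sum>v\<in>V. w v) = 0" using bal[of V] by simp
    then show "(\<Sum>v\<in>V. b v) = 0" using bsum[of V] net_sum_V by simp
  next
    fix X assume X: "X \<subseteq> V"
    then have finX: "finite X" using finite_V finite_subset by blast
    let ?out = "{e \<in> E. t e \<in> X \<and> h e \<notin> X}" and ?in = "{e \<in> E. t e \<notin> X \<and> h e \<in> X}"
    note 1 = net_one_sum[OF finX] card_bd[of X]
    \<comment> \<open>The left side is w(X) + |out| - |in|, and w(X) is at most |out| +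
      |in|.\<close>
    have "2 * (\<Sum>v\<in>X. b v) \<le> 2 * int (card ?out)"
      using bal[OF X] bsum[OF X] 1 by linarith
    then show "(\<Sum>v\<in>X. b v) \<le> (\<Sum>e\<in>?out. 1) - (\<Sum>e\<in>?in. 0)" by simp
  qed simp
  then obtain g where feas: "feasible (\<lambda>_. 0) (\<lambda>_. 1) g" and gb: "\<And>v. v \<in> V \<Longrightarrow> net g v = b v"
    by blast
  have g: "g e = 0 \<or> g e = 1" if "e \<in> E" for e
  proof -
    have "0 \<le> g e \<and> g e \<le> 1" using feas that unfolding feasible_def by blast
    then show ?thesis by linarith
  qed
  define t' h' where "t' e = (if g e = 1 then t e else h e)" and "h' e = (if g e = 1 then h e else t e)" for e
  have m: "multigraph V E t' h'"
    by standard (auto simp: finite_V finite_E t'_def h'_def tail_in_V head_in_V)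
  show ?thesis
  proof (rule that[OF m])
    show "{#t' e, h' e#} = {#t e, h e#}" for e by (simp add: t'_def h'_def)
    fix v assume v: "v \<in> V"
    have "multigraph.net E t' h' (\<lambda>_. 1) v =
        (\<Sum>e\<in>E. 2 * (g e * (of_bool (t e = v) - of_bool (h e = v)))
          - 1 * (of_bool (t e = v) - of_bool (h e = v)))"
      unfolding multigraph.net_def[OF m] using g by (intro sum.cong) (auto simp: t'_def h'_def)
    also have "\<dots> = 2 * net g v - net (\<lambda>_. 1) v"
      unfolding net_def by (simp only: sum_subtractf sum_distrib_left)
    finally show "multigraph.net E t' h' (\<lambda>_. 1) v = w v" using gb[OF v] b[OF v] by simp
  qed
qed

text \<open>If o edges leave \<open>X\<close> and i edges enter it, then 5 |o - i| \<le> 3 (o + i)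
  gives i \<le> 4 o, which is Hoffman's condition for the bounds 1 and 4 and zero demand.\<close>

lemma flow_1_4:
  assumes bal: "\<And>X. X \<subseteq> V \<Longrightarrow> 5 * \<bar>\<Sum>v\<in>X. net (\<lambda>_. 1) v\<bar> \<le> 3 * int (card (bd E X))"
  shows "\<exists>f. (\<forall>e\<in>E. 1 \<le> f e \<and> f e \<le> 4) \<and> (\<forall>v\<in>V. net f v = 0)"
proof -
  have "\<exists>f. feasible (\<lambda>_. 1) (\<lambda>_. 4) f \<and> (\<forall>v\<in>V. net f v = 0)"
  proof (rule hoffman)
    fix X assume X: "X \<subseteq> V"
    then have finX: "finite X" using finite_V finite_subset by blast
    let ?out = "{e \<in> E. t e \<in> X \<and> h e \<notin> X}" and ?in = "{e \<in> E. t e \<notin> X \<and> h e \<in> X}"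
    note 1 = net_one_sum[OF finX] card_bd[of X]
    have "int (card ?in) \<le> 4 * int (card ?out)"
      using bal[OF X] 1 by linarith
    then show "(\<Sum>v\<in>X. 0) \<le> (\<Sum>e\<in>?out. 4) - (\<Sum>e\<in>?in. (1::int))" by simp
  qed simp_all
  then show ?thesis by (simp add: feasible_def)
qed

section \<open>Degrees and matchings\<close>

lemma deg_0: "F \<subseteq> E \<Longrightarrow> v \<notin> V \<Longrightarrow> deg F v = 0"
  unfolding deg_def by (rule sum.neutral) (use tail_in_V head_in_V in auto)

lemma deg_insert:
  "finite F \<Longrightarrow> e \<notin> F \<Longrightarrow> deg (insert e F) v = deg F v + (of_bool (t e = v) + of_bool (h e = v))"
  by (simp add: deg_def)

lemma deg_remove:
  "finite F \<Longrightarrow> e \<in> F \<Longrightarrow> deg F v = deg (F - {e}) v + (of_bool (t e = v) + of_bool (h e = v))"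
  by (simp add: deg_def sum.remove)

lemma deg_Diff: "finite F \<Longrightarrow> F' \<subseteq> F \<Longrightarrow> deg F v = deg F' v + deg (F - F') v"
  unfolding deg_def by (subst sum.subset_diff[of F']) auto

lemma deg_mono: "finite F \<Longrightarrow> F' \<subseteq> F \<Longrightarrow> deg F' v \<le> deg F v"
  using deg_Diff[of F F' v] by simp

lemma deg_eq_0_iff: "finite F \<Longrightarrow> deg F v = 0 \<longleftrightarrow> (\<forall>e\<in>F. t e \<noteq> v \<and> h e \<noteq> v)"
  by (auto simp: deg_def)

text \<open>Double counting with weights: constant weights give the handshake lemma, weights of
  opposite sign at the ends of each edge give \<open>bichromatic_sum\<close>.\<close>

lemma deg_sum:
  fixes c :: "'v \<Rightarrow> int"
  assumes "finite X"
  shows "(\<Sum>v\<in>X. c v * int (deg F v)) =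
    (\<Sum>e\<in>F. c (t e) * of_bool (t e \<in> X) + c (h e) * of_bool (h e \<in> X))"
proof -
  have "(\<Sum>v\<in>X. c v * int (deg F v)) =
      (\<Sum>e\<in>F. \<Sum>v\<in>X. c v * (of_bool (t e = v) + of_bool (h e = v)))"
    unfolding deg_def by (subst sum.swap) (simp add: sum_distrib_left)
  also have "\<dots> = (\<Sum>e\<in>F. (\<Sum>v\<in>X. if t e = v then c v else 0) + (\<Sum>v\<in>X. if h e = v then c v else 0))"
    unfolding sum.distrib[symmetric] by (intro sum.cong) auto
  also have "\<dots> = (\<Sum>e\<in>F. c (t e) * of_bool (t e \<in> X) + c (h e) * of_bool (h e \<in> X))"
    using assms by (intro sum.cong) auto
  finally show ?thesis .
qed

lemma deg_sum_card:
  assumes "finite F" "finite X"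
  shows "(\<Sum>v\<in>X. deg F v) = card (bd F X) + 2 * card {e \<in> F. t e \<in> X \<and> h e \<in> X}"
proof -
  have "int (\<Sum>v\<in>X. deg F v) = (\<Sum>e\<in>F. of_bool (t e \<in> X) + of_bool (h e \<in> X))"
    using deg_sum[OF assms(2), of "\<lambda>_. 1" F] by simp
  also have "\<dots> = (\<Sum>e\<in>F. (if (t e \<in> X) \<noteq> (h e \<in> X) then 1 else 0) + (if t e \<in> X \<and> h e \<in> X then 2 else 0))"
    by (intro sum.cong) auto
  also have "\<dots> = int (card (bd F X) + 2 * card {e \<in> F. t e \<in> X \<and> h e \<in> X})"
    unfolding sum.distrib sum.inter_filter[OF assms(1), symmetric] bd_def by simp
  finally show ?thesis by (simp only: of_nat_eq_iff)
qed

lemma bd_V: "F \<subseteq> E \<Longrightarrow> bd F V = {}"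
  by (auto simp: bd_def tail_in_V head_in_V)

lemma deg_sum_V:
  assumes "F \<subseteq> E"
  shows "(\<Sum>v\<in>V. deg F v) = 2 * card F"
proof -
  have "{e \<in> F. t e \<in> V \<and> h e \<in> V} = F" using assms tail_in_V head_in_V by auto
  then show ?thesis
    using deg_sum_card[OF finite_subset[OF assms finite_E] finite_V] bd_V[OF assms] by simp
qed

section \<open>Maximum matchings\<close>

lemma symp_adj: "symp (adj F)"
  by (auto simp: symp_def adj_def)

text \<open>A loop counts 2 in \<open>deg\<close>, so the bound also keeps loops out of
  matchings.\<close>

definition matching :: "'e set \<Rightarrow> bool" where
  "matching M \<longleftrightarrow> (\<forall>v. deg M v \<le> 1)"

definition max_matching :: "'e set \<Rightarrow> 'e set \<Rightarrow> bool" where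
  "max_matching F M \<longleftrightarrow>
     M \<subseteq> F \<and> matching M \<and> (\<forall>M'. M' \<subseteq> F \<and> matching M' \<longrightarrow> card M' \<le> card M)"

lemma max_matching_exists:
  assumes "finite F"
  shows "\<exists>M. max_matching F M"
proof -
  have "{} \<subseteq> F \<and> matching {}" by (simp add: matching_def deg_def)
  moreover have "\<forall>M. M \<subseteq> F \<and> matching M \<longrightarrow> card M < Suc (card F)"
    using assms by (simp add: card_mono le_imp_less_Suc)
  ultimately show ?thesis
    using ex_has_greatest_nat[of "\<lambda>M. M \<subseteq> F \<and> matching M" "{}" card "Suc (card F)"]
    unfolding max_matching_def by blast
qed

text \<open>Along a walk between two unmatched vertices, exchanging one matching edge moves an unmatched
  end two steps closer to the other end.\<close>

lemma max_matching_unmatched_unique: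
  assumes F: "finite F" and deg2: "\<And>v. deg F v \<le> 2"
    and "(adj F ^^ n) u v" "max_matching F M" "deg M u = 0" "deg M v = 0"
  shows "u = v"
  using assms(3-)
proof (induction n arbitrary: M u rule: less_induct)
  case (less n)
  show ?case
  proof (rule ccontr)
    assume uv: "u \<noteq> v"
    have M: "M \<subseteq> F" "matching M" and max: "\<And>M'. M' \<subseteq> F \<Longrightarrow> matching M' \<Longrightarrow> card M' \<le> card M"
      using less.prems(2) by (auto simp: max_matching_def)
    have finM: "finite M" using M(1) F finite_subset by blast
    note M0 = deg_eq_0_iff[OF finM]
    obtain m where m: "n = Suc m" using uv less.prems(1) by (cases n) auto
    obtain x where x: "adj F u x" "(adj F ^^ m) x v"
      using less.prems(1) unfolding m by (metis relpowp_Suc_D2)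
    have xu: "x \<noteq> u" using less.IH[of m x M] x(2) less.prems uv m by auto
    obtain e where e: "e \<in> F" "t e = u \<and> h e = x \<or> t e = x \<and> h e = u"
      using x(1) unfolding adj_def by blast
    have eM: "e \<notin> M" using less.prems(3) e(2) M0 by blast
    have inc_e: "of_bool (t e = z) + of_bool (h e = z) = (of_bool (z = u) + of_bool (z = x) :: nat)" for z
      using e(2) by auto
    have "deg M x \<noteq> 0"
    proof
      assume "deg M x = 0"
      then have "deg (insert e M) z \<le> 1" for z
        using M(2) less.prems(3) xu deg_insert[OF finM eM, of z] unfolding inc_e matching_def
        by (cases "z = u"; cases "z = x") auto
      then have "card (insert e M) \<le> card M"
        using M(1) e(1) by (intro max) (auto simp: matching_def)
      then show False using finM eM by simp
    qed
    then obtain g where g: "g \<in> M" "t g = x \<or> h g = x" using M0[of x] by auto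
    define y where "y = (if t g = x then h g else t g)"
    have inc_g: "of_bool (t g = z) + of_bool (h g = z) = (of_bool (z = x) + of_bool (z = y) :: nat)" for z
      using g(2) by (auto simp: y_def)
    note dg = deg_remove[OF finM g(1), unfolded inc_g]
    have yx: "y \<noteq> x" using M(2)[unfolded matching_def, rule_format, of x] dg[of x] by auto
    have yu: "y \<noteq> u" using dg[of u] less.prems(3) by auto
    have xv: "x \<noteq> v" using dg[of v] less.prems(4) by auto
    have yv: "y \<noteq> v" using dg[of v] less.prems(4) by auto
    obtain k where k: "m = Suc k" using xv x(2) by (cases m) auto
    obtain z where z: "adj F x z" "(adj F ^^ k) z v"
      using x(2) unfolding k by (metis relpowp_Suc_D2)
    obtain e' where e': "e' \<in> F" "t e' = x \<and> h e' = z \<or> t e' = z \<and> h e' = x"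
      using z(1) unfolding adj_def by blast
    \<comment> \<open>\<open>e\<close> and \<open>g\<close> are distinct edges at \<open>x\<close>,
      and \<open>x\<close> has degree at most 2; so the walk either returns to \<open>u\<close> or
      follows the matching edge \<open>g\<close>.\<close>
    have "e' = e \<or> e' = g"
    proof (rule ccontr)
      assume ne: "\<not> (e' = e \<or> e' = g)"
      have "e \<noteq> g" using g eM by auto
      then have "deg {e, g, e'} x \<ge> 3" using ne e(2) g(2) e'(2) by (auto simp: deg_def)
      moreover have "deg {e, g, e'} x \<le> deg F x" using e e' g M(1) F by (intro deg_mono) auto
      ultimately show False using deg2[of x] by simp
    qed
    then have "z = u \<or> z = y" using e(2) e'(2) g(2) xu yx by (auto simp: y_def split: if_splits)
    then show False
    proof
      assume "z = u"
      then show False using less.IH[of k u M] z(2) less.prems uv m k by auto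
    next
      assume zy: "z = y"
      \<comment> \<open>Exchanging \<open>g\<close> for \<open>e\<close> keeps the cardinality and
        moves the unmatched vertex from \<open>u\<close> to \<open>y\<close>, which has a walk of
        length \<open>k = n - 2\<close> to \<open>v\<close>.\<close>
      let ?M = "insert e (M - {g})"
      have dM: "deg ?M w + of_bool (w = y) = deg M w + of_bool (w = u)" for w
        using deg_insert[of "M - {g}" e w] dg[of w] finM eM unfolding inc_e by simp
      have mM: "matching ?M" unfolding matching_def
      proof
        fix w show "deg ?M w \<le> 1"
          using dM[of w] M(2)[unfolded matching_def, rule_format, of w] less.prems(3) by (cases "w = u") auto
      qed
      have "card ?M = card M" using card_Suc_Diff1[OF finM g(1)] finM eM by simp
      then have "max_matching F ?M"
        using mM M(1) e(1) max unfolding max_matching_def by auto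
      moreover have "deg ?M y = 0" using dM[of y] M(2)[unfolded matching_def, rule_format, of y] yu by simp
      moreover have "deg ?M v = 0" using dM[of v] less.prems(4) yv uv by simp
      ultimately have "y = v" using less.IH[of k y ?M] z(2) zy m k by auto
      then show False using yv by simp
    qed
  qed
qed

section \<open>Sign colourings of the union of two matchings\<close>

lemma matching_involution:
  assumes "finite M" "matching M"
  obtains p where "\<And>x. p (p x) = x" "finite {x. p x \<noteq> x}" "\<And>e. e \<in> M \<Longrightarrow> p (t e) = h e \<and> t e \<noteq> h e"
proof -
  have loop: "t e \<noteq> h e" if "e \<in> M" for e
  proof
    assume "t e = h e"
    then have "deg M (t e) \<ge> 2" using deg_remove[OF assms(1) that, of "t e"] by simp
    moreover have "deg M (t e) \<le> 1" using assms(2) by (simp add: matching_def)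
    ultimately show False by simp
  qed
  have share: "e = e'" if "e \<in> M" "e' \<in> M" "t e = v \<or> h e = v" "t e' = v \<or> h e' = v" for e e' v
  proof (rule ccontr)
    assume "e \<noteq> e'"
    then have "deg {e, e'} v \<ge> 2" using that by (auto simp: deg_def)
    moreover have "deg {e, e'} v \<le> deg M v" using that assms(1) by (intro deg_mono) auto
    moreover have "deg M v \<le> 1" using assms(2) by (simp add: matching_def)
    ultimately show False by simp
  qed
  have uniq: "y = z" if "adj M x y" "adj M x z" for x y z
    using that share[of _ _ x] unfolding adj_def by metis
  have sym: "adj M x y \<Longrightarrow> adj M y x" for x y using symp_adj by (rule sympD)
  \<comment> \<open>\<open>p\<close> swaps the ends of each matching edge and fixes the unmatched
    vertices; its finite support is what the induction for the colouring runs on.\<close>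
  define p where "p x = (if \<exists>y. adj M x y then THE y. adj M x y else x)" for x
  have p: "p x = y" if "adj M x y" for x y
    unfolding p_def using that uniq by (auto intro!: the_equality)
  have p': "p x = x" if "\<nexists>y. adj M x y" for x using that by (simp add: p_def)
  have "p (p x) = x" for x
    using p p' sym by (cases "\<exists>y. adj M x y") (metis, simp)
  moreover have "{x. p x \<noteq> x} \<subseteq> t ` M \<union> h ` M"
  proof
    fix x assume "x \<in> {x. p x \<noteq> x}"
    then obtain y where "adj M x y" using p'[of x] by auto
    then show "x \<in> t ` M \<union> h ` M" unfolding adj_def by auto
  qed
  then have "finite {x. p x \<noteq> x}" by (rule finite_subset) (use assms(1) in auto)
  moreover have "p (t e) = h e \<and> t e \<noteq> h e" if "e \<in> M" for e
    using p[of "t e" "h e"] that loop unfolding adj_def by blast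
  ultimately show ?thesis using that by blast
qed

end

text \<open>The choice from \<open>{x, q x}\<close> depends only on this set, so it marks exactly
  one element of each swapped pair.\<close>

lemma involution_colouring:
  fixes q :: "'a \<Rightarrow> 'a"
  assumes "\<And>x. q (q x) = x"
  shows "\<exists>w :: 'a \<Rightarrow> int. \<forall>x. (w x = 1 \<or> w x = -1) \<and> (q x \<noteq> x \<longrightarrow> w (q x) = - w x)"
proof -
  define r where "r x = (SOME y. y \<in> {x, q x})" for x
  have r: "r x \<in> {x, q x}" for x unfolding r_def by (rule someI_ex) auto
  have rq: "r (q x) = r x" for x unfolding r_def assms by (simp add: insert_commute)
  show ?thesis
    by (intro exI[of _ "\<lambda>x. if r x = x then 1 else -1"]) (use r rq in auto)
qed

text \<open>The union of two matchings is bipartite; a matching edge \<open>{a, b}\<close> is contracted together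
  with the edges of the other matching at its ends.\<close>

lemma two_involutions_colouring:
  fixes p q :: "'a \<Rightarrow> 'a"
  assumes "finite {x. p x \<noteq> x}" "\<And>x. p (p x) = x" "\<And>x. q (q x) = x"
  shows "\<exists>w :: 'a \<Rightarrow> int. \<forall>x. (w x = 1 \<or> w x = -1) \<and>
    (p x \<noteq> x \<longrightarrow> w (p x) = - w x) \<and> (q x \<noteq> x \<longrightarrow> w (q x) = - w x)"
  using assms
proof (induction "card {x. p x \<noteq> x}" arbitrary: p q rule: less_induct)
  case less
  show ?case
  proof (cases "\<exists>a. p a \<noteq> a")
    case False
    then show ?thesis using involution_colouring[OF less.prems(3)] by metis
  next
    case True
    then obtain a where a: "p a \<noteq> a" by blast
    define b where "b = p a"
    have b: "b \<noteq> a" "p a = b" "p b = a" using a less.prems(2) by (auto simp: b_def)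
    define p' where "p' x = (if x = a \<or> x = b then x else p x)" for x
    \<comment> \<open>\<open>a\<close> and \<open>b\<close> become fixed points, and their partners
      outside \<open>{a, b}\<close> are joined to each other; a partner left alone becomes a fixed
      point too.\<close>
    define q' where "q' x = (if x = a \<or> x = b then x
      else if q x = a then (if q b = b then x else q b)
      else if q x = b then (if q a = a then x else q a) else q x)" for x
    have qi: "q x = y \<longleftrightarrow> q y = x" for x y using less.prems(3) by metis
    have pi: "p x = y \<longleftrightarrow> p y = x" for x y using less.prems(2) by metis
    have p'p': "p' (p' x) = x" for x using pi less.prems(2)[of x] b by (auto simp: p'_def)
    have q'q': "q' (q' x) = x" for x unfolding q'_def using qi b(1) by (smt (verit))
    have "{x. p' x \<noteq> x} \<subset> {x. p x \<noteq> x}" using a by (auto simp: p'_def)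
    then have "card {x. p' x \<noteq> x} < card {x. p x \<noteq> x}" "finite {x. p' x \<noteq> x}"
      using less.prems(1) by (auto intro: psubset_card_mono finite_subset)
    then obtain w :: "'a \<Rightarrow> int" where w: "\<And>x. w x = 1 \<or> w x = -1"
      "\<And>x. p' x \<noteq> x \<Longrightarrow> w (p' x) = - w x" "\<And>x. q' x \<noteq> x \<Longrightarrow> w (q' x) = - w x"
      using less.hyps[OF _ _ p'p' q'q'] by metis
    \<comment> \<open>\<open>a\<close> gets the sign \<open>c\<close> and \<open>b\<close> gets
      \<open>- c\<close>. A partner \<open>q a\<close> or \<open>q b\<close> outside the pair forces
      the sign; if both exist, \<open>q'\<close> joins them, so that their demands agree.\<close>
    define c :: int where "c = (if q a = b then 1 else if q a \<noteq> a then - w (q a)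
      else if q b \<noteq> b then w (q b) else 1)"
    define w' where "w' x = (if x = a then c else if x = b then - c else w x)" for x
    have c: "c = 1 \<or> c = -1" using w(1)[of "q a"] w(1)[of "q b"] unfolding c_def by auto
    have 1: "w' x = 1 \<or> w' x = -1" for x unfolding w'_def using c w(1)[of x] by auto
    have 2: "w' (p x) = - w' x" if "p x \<noteq> x" for x
    proof (cases "x = a \<or> x = b")
      case True
      then show ?thesis using b by (auto simp: w'_def)
    next
      case False
      then have "p x \<noteq> a" "p x \<noteq> b" using pi b by metis+
      then show ?thesis using False w(2)[of x] that by (simp add: w'_def p'_def)
    qed
    have qa: "w' (q a) = - c" if "q a \<noteq> a"
      using that b(1) unfolding w'_def c_def by auto
    have qb: "w' (q b) = c" if "q b \<noteq> b"
    proof (cases "q b = a \<or> q a = a")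
      case True
      then show ?thesis using that b(1) qi[of a b] unfolding w'_def c_def by auto
    next
      case False
      then have "q a \<noteq> b" "q a \<noteq> q b" using qi b(1) by metis+
      then have "q' (q a) = q b" "q' (q a) \<noteq> q a"
        using False that less.prems(3) by (auto simp: q'_def)
      then have "w (q b) = - w (q a)" using w(3)[of "q a"] by simp
      then show ?thesis using False that \<open>q a \<noteq> b\<close> unfolding w'_def c_def by auto
    qed
    have 3: "w' (q x) = - w' x" if "q x \<noteq> x" for x
    proof -
      consider "x = a" | "x = b" | "q x = a" | "q x = b" | "x \<noteq> a" "x \<noteq> b" "q x \<noteq> a" "q x \<noteq> b" by blast
      then show ?thesis
      proof cases
        case 1 then show ?thesis using qa that by (simp add: w'_def)
      next
        case 2 then show ?thesis using qb that b(1) by (simp add: w'_def)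
      next
        case 3
        then have "q a = x" using qi by blast
        then show ?thesis using qa that 3 by (simp add: w'_def)
      next
        case 4
        then have "q b = x" using qi by blast
        then show ?thesis using qb that 4 b(1) by (simp add: w'_def)
      next
        case 5
        then show ?thesis using w(3)[of x] that by (simp add: w'_def q'_def)
      qed
    qed
    show ?thesis by (intro exI[of _ w'] allI conjI impI) (use 1 2 3 in auto)
  qed
qed

context multigraph
begin

lemma two_matchings_colouring:
  assumes "finite M" "matching M" "finite N" "matching N"
  obtains w :: "'v \<Rightarrow> int" where "\<And>v. w v = 1 \<or> w v = -1"
    "\<And>e. e \<in> M \<union> N \<Longrightarrow> w (h e) = - w (t e)"
proof -
  obtain p where p: "\<And>x. p (p x) = x" "finite {x. p x \<noteq> x}" "\<And>e. e \<in> M \<Longrightarrow> p (t e) = h e \<and> t e \<noteq> h e"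
    using matching_involution[OF assms(1,2)] by metis
  obtain q where q: "\<And>x. q (q x) = x" "finite {x. q x \<noteq> x}" "\<And>e. e \<in> N \<Longrightarrow> q (t e) = h e \<and> t e \<noteq> h e"
    using matching_involution[OF assms(3,4)] by metis
  obtain w :: "'v \<Rightarrow> int" where w: "\<forall>x. (w x = 1 \<or> w x = -1) \<and>
    (p x \<noteq> x \<longrightarrow> w (p x) = - w x) \<and> (q x \<noteq> x \<longrightarrow> w (q x) = - w x)"
    using two_involutions_colouring[of p q] p q by blast
  show ?thesis
  proof (rule that[of w])
    show "w v = 1 \<or> w v = -1" for v using w by blast
    fix e assume "e \<in> M \<union> N"
    then show "w (h e) = - w (t e)" using p(3)[of e] q(3)[of e] w[rule_format, of "t e"] by auto
  qed
qed

text \<open>The two contributions of an edge inside \<open>X\<close> cancel, and an edge with one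
  end in \<open>X\<close> contributes 1 in absolute value.\<close>

lemma bichromatic_sum:
  fixes w :: "'v \<Rightarrow> int"
  assumes "finite M" "finite X" and w: "\<And>v. w v = 1 \<or> w v = -1"
    and "\<And>e. e \<in> M \<Longrightarrow> w (h e) = - w (t e)"
  shows "\<bar>\<Sum>v\<in>X. w v * int (deg M v)\<bar> \<le> int (card (bd M X))"
proof -
  have "\<bar>\<Sum>v\<in>X. w v * int (deg M v)\<bar> \<le>
      (\<Sum>e\<in>M. \<bar>w (t e) * of_bool (t e \<in> X) + w (h e) * of_bool (h e \<in> X)\<bar>)"
    unfolding deg_sum[OF assms(2)] by (rule sum_abs)
  also have "\<dots> = (\<Sum>e\<in>M. if (t e \<in> X) \<noteq> (h e \<in> X) then 1 else 0)"
  proof (rule sum.cong)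
    fix e assume "e \<in> M"
    then show "\<bar>w (t e) * of_bool (t e \<in> X) + w (h e) * of_bool (h e \<in> X)\<bar> =
        (if (t e \<in> X) \<noteq> (h e \<in> X) then 1 else 0)"
      using assms(4)[of e] w[of "t e"] by auto
  qed simp
  also have "\<dots> = int (card (bd M X))"
    unfolding bd_def sum.inter_filter[OF assms(1), symmetric] by simp
  finally show ?thesis .
qed

section \<open>Balanced valuations\<close>

text \<open>The boundary is nonempty because the component is connected and not contained in
  \<open>X\<close>, and its size is even because all degrees in \<open>F\<close> are 2.\<close>

lemma two_le_card_bd_component:
  assumes F: "F \<subseteq> E" "\<And>v. v \<in> V \<Longrightarrow> deg F v = 2"
    and X: "X \<subseteq> V" "v \<in> X" "\<not> {y. (adj F)\<^sup>*\<^sup>* v y} \<subseteq> X"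
  shows "2 \<le> card (bd F ({y. (adj F)\<^sup>*\<^sup>* v y} \<inter> X))"
proof -
  let ?C = "{y. (adj F)\<^sup>*\<^sup>* v y}"
  have finF: "finite F" and finX: "finite (?C \<inter> X)"
    using F(1) finite_E X(1) finite_V finite_subset by (blast, metis finite_Int finite_subset)
  have "bd F (?C \<inter> X) \<noteq> {}"
  proof
    assume e0: "bd F (?C \<inter> X) = {}"
    have "y \<in> X" if "(adj F)\<^sup>*\<^sup>* v y" for y
      using that
    proof (induction rule: rtranclp_induct)
      case base
      then show ?case using X(2) .
    next
      case (step y z)
      then obtain e where "e \<in> F" "t e = y \<and> h e = z \<or> t e = z \<and> h e = y" unfolding adj_def by blast
      moreover have "(adj F)\<^sup>*\<^sup>* v z" using step.hyps by (rule rtranclp.rtrancl_into_rtrancl)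
      moreover have "e \<notin> bd F (?C \<inter> X)" using e0 by blast
      ultimately show ?case using step by (auto simp: bd_def)
    qed
    then show False using X(3) by blast
  qed
  moreover have "finite (bd F (?C \<inter> X))" using finF by (simp add: bd_def)
  moreover have "even (card (bd F (?C \<inter> X)))"
  proof -
    have "(\<Sum>x\<in>?C \<inter> X. deg F x) = (\<Sum>x\<in>?C \<inter> X. 2)" using F(2) X(1) by (intro sum.cong) auto
    then have "even (\<Sum>x\<in>?C \<inter> X. deg F x)" by simp
    then show ?thesis unfolding deg_sum_card[OF finF finX] by simp
  qed
  ultimately show ?thesis by (metis card_0_eq dvd_imp_le gr0I)
qed

text \<open>Different points of \<open>S\<close> lie in different components of \<open>F\<close>, so
  the boundaries of these components' parts in \<open>X\<close> are disjoint. They lie in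
  \<open>bd F X\<close>, since no edge of \<open>F\<close> leaves a component.\<close>

lemma two_mult_card_le_card_bd:
  assumes F: "F \<subseteq> E" "\<And>v. v \<in> V \<Longrightarrow> deg F v = 2"
    and X: "X \<subseteq> V" "S \<subseteq> X" "\<And>v. v \<in> S \<Longrightarrow> \<not> {y. (adj F)\<^sup>*\<^sup>* v y} \<subseteq> X"
    and uniq: "\<And>u v. u \<in> S \<Longrightarrow> v \<in> S \<Longrightarrow> (adj F)\<^sup>*\<^sup>* u v \<Longrightarrow> u = v"
  shows "2 * card S \<le> card (bd F X)"
proof -
  define C where "C v = {y. (adj F)\<^sup>*\<^sup>* v y}" for v
  define K where "K v = bd F (C v \<inter> X)" for v
  have finF: "finite F" and finS: "finite S"
    using F(1) finite_E X(1,2) finite_V by (auto intro: finite_subset)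
  have finK: "finite (K v)" for v using finF by (simp add: K_def bd_def)
  have C_closed: "y \<in> C v \<longleftrightarrow> z \<in> C v" if "adj F y z" for v y z
    using that symp_adj[of F] unfolding C_def by (auto dest: sympD intro: rtranclp.rtrancl_into_rtrancl)
  have C_ends: "t e \<in> C v \<longleftrightarrow> h e \<in> C v" if "e \<in> F" for e v
    by (rule C_closed) (use that in \<open>auto simp: adj_def\<close>)
  have K_C: "t e \<in> C v" "e \<in> bd F X" if "e \<in> K v" for e v
    using that C_ends[of e v] by (auto simp: K_def bd_def)
  have disj: "K u \<inter> K v = {}" if "u \<in> S" "v \<in> S" "u \<noteq> v" for u v
  proof (rule ccontr)
    assume "K u \<inter> K v \<noteq> {}"
    then obtain y where "(adj F)\<^sup>*\<^sup>* u y" "(adj F)\<^sup>*\<^sup>* v y" using K_C(1) unfolding C_def by blast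
    then have "(adj F)\<^sup>*\<^sup>* u v"
      using sympD[OF symp_rtranclp[OF symp_adj]] by (metis rtranclp_trans)
    then show False using uniq that by blast
  qed
  have "(\<Sum>v\<in>S. 2) \<le> (\<Sum>v\<in>S. card (K v))"
    using two_le_card_bd_component[OF F X(1)] X(2,3) unfolding K_def C_def by (intro sum_mono) auto
  also have "\<dots> = card (\<Union>v\<in>S. K v)"
    using finS finK disj by (intro card_UN_disjoint[symmetric]) auto
  also have "\<dots> \<le> card (bd F X)"
    using K_C(2) finF by (intro card_mono) (auto simp: bd_def)
  finally show ?thesis by simp
qed

text \<open>With n = |s| + 2 k the claim reads |s| \<le> 3 k. The first three assumptions give 4 |s|
  \<le> 12 k + 3, and integrality does the rest; this is the origin of the constant 3 in the
  connectivity bound.\<close>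

lemma balanced_if_large_cut:
  fixes s \<tau> g n :: int
  assumes "2 * \<bar>s\<bar> \<le> n + \<bar>\<tau>\<bar>" "\<bar>\<tau>\<bar> \<le> g" "5 * g \<le> n + 3" "even (s - n)"
  shows "5 * \<bar>s\<bar> \<le> 3 * n"
proof -
  have "even (n - \<bar>s\<bar>)" using assms(4) by auto
  then obtain k where k: "n = \<bar>s\<bar> + 2 * k" by (metis add.commute diff_add_cancel dvdE)
  show ?thesis
  proof (rule ccontr)
    assume "\<not> ?thesis"
    then have "3 * k < \<bar>s\<bar>" using k by linarith
    then show False using assms k by linarith
  qed
qed

text \<open>Cyclic connectivity enters through the last hypothesis: a cut with a whole component of
  the 2-factor \<open>E - M1\<close> on each side is large.\<close>

lemma balanced_valuation_exists:
  assumes deg3: "\<And>v. v \<in> V \<Longrightarrow> deg E v = 3"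
    and M1: "M1 \<subseteq> E" "\<And>v. v \<in> V \<Longrightarrow> deg M1 v = 1"
    and M2: "M2 \<subseteq> E" "\<And>v. v \<in> V \<Longrightarrow> deg M2 v = 1"
    and cyc: "\<And>X u v. X \<subseteq> V \<Longrightarrow> u \<in> X \<Longrightarrow> v \<in> V - X \<Longrightarrow> {y. (adj (E - M1))\<^sup>*\<^sup>* u y} \<subseteq> X \<Longrightarrow>
      {y. (adj (E - M1))\<^sup>*\<^sup>* v y} \<subseteq> V - X \<Longrightarrow> 5 * card (M1 \<inter> M2) \<le> card (bd E X) + 3"
  obtains w :: "'v \<Rightarrow> int" where "\<And>v. w v = 1 \<or> w v = -1"
    "\<And>X. X \<subseteq> V \<Longrightarrow> 5 * \<bar>\<Sum>v\<in>X. w v\<bar> \<le> 3 * int (card (bd E X))"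
proof -
  define F where "F = E - M1"
  have FE: "F \<subseteq> E" and finF: "finite F" and fin1: "finite M1" and fin2: "finite M2"
    using finite_E M1 M2 by (auto simp: F_def intro: finite_subset)
  have degF: "deg F v = 2" if "v \<in> V" for v
    using deg_Diff[OF finite_E M1(1), of v] deg3 M1(2) that by (simp add: F_def)
  have degF': "deg F v \<le> 2" for v using degF[of v] deg_0[OF FE, of v] by (cases "v \<in> V") auto
  have mat1: "matching M1" and mat2: "matching M2"
    unfolding matching_def using M1 M2 deg_0 by (metis le_refl zero_le)+
  obtain M where M: "max_matching F M" using max_matching_exists[OF finF] by blast
  then have MF: "M \<subseteq> F" and matM: "matching M" by (auto simp: max_matching_def)
  have ME: "M \<subseteq> E" and finM: "finite M" using MF FE finF finite_subset by auto
  define T where "T = {v \<in> V. deg M v = 0}"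
  have TV: "T \<subseteq> V" and finT: "finite T" using finite_V by (auto simp: T_def)
  have degM: "deg M v = of_bool (v \<notin> T)" if "v \<in> V" for v
    using matM[unfolded matching_def, rule_format, of v] that by (auto simp: T_def)
  have uniq: "u = v" if "u \<in> T" "v \<in> T" "(adj F)\<^sup>*\<^sup>* u v" for u v
    using that max_matching_unmatched_unique[OF finF degF' _ M] unfolding T_def
    by (auto simp: rtranclp_power)
  have cardT: "card T \<le> 2 * card (M1 \<inter> M2)"
  proof -
    have "(\<Sum>v\<in>V. deg M v) = (\<Sum>v\<in>V. if v \<in> V - T then 1 else 0)"
      using degM by (intro sum.cong) auto
    also have "\<dots> = card (V - T)"
      unfolding sum.inter_filter[OF finite_V, symmetric] by (simp add: set_diff_eq)
    finally have 1: "card V - card T = 2 * card M"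
      using deg_sum_V[OF ME] card_Diff_subset[OF finT TV] by simp
    have 2: "card V = 2 * card M2"
      using deg_sum_V[OF M2(1)] M2(2) by simp
    have "matching (M2 - M1)"
      unfolding matching_def
      by (intro allI le_trans[OF deg_mono[OF fin2 Diff_subset]]) (use mat2 in \<open>simp add: matching_def\<close>)
    moreover have "M2 - M1 \<subseteq> F" using M2(1) by (auto simp: F_def)
    ultimately have "card (M2 - M1) \<le> card M" using M by (simp add: max_matching_def)
    moreover have "card M2 = card (M2 - M1) + card (M1 \<inter> M2)"
      using card_Int_Diff[OF fin2, of M1] by (simp add: Int_commute)
    ultimately show ?thesis using 1 2 card_mono[OF finite_V TV] by linarith
  qed
  obtain w :: "'v \<Rightarrow> int" where w: "\<And>v. w v = 1 \<or> w v = -1" "\<And>e. e \<in> M1 \<union> M \<Longrightarrow> w (h e) = - w (t e)"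
    using two_matchings_colouring[OF fin1 mat1 finM matM] by metis
  have b1: "\<bar>\<Sum>v\<in>X. w v\<bar> \<le> int (card (bd M1 X))" if "X \<subseteq> V" for X
  proof -
    have "(\<Sum>v\<in>X. w v * int (deg M1 v)) = (\<Sum>v\<in>X. w v)" using that M1(2) by (intro sum.cong) auto
    then show ?thesis
      using bichromatic_sum[of M1 X w, OF fin1 finite_subset[OF that finite_V] w(1)] w(2) by simp
  qed
  have bM: "\<bar>(\<Sum>v\<in>X. w v) - (\<Sum>v\<in>X \<inter> T. w v)\<bar> \<le> int (card (bd M X))" if "X \<subseteq> V" for X
  proof -
    have finX: "finite X" using that finite_V finite_subset by blast
    have "(\<Sum>v\<in>X. w v * int (deg M v)) = (\<Sum>v\<in>X. w v - (if v \<in> T then w v else 0))"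
      using that degM by (intro sum.cong) auto
    also have "\<dots> = (\<Sum>v\<in>X. w v) - (\<Sum>v\<in>X \<inter> T. w v)"
      using finX by (simp add: sum_subtractf sum.inter_restrict)
    finally show ?thesis using bichromatic_sum[of M X w, OF finM finX w(1)] w(2) by simp
  qed
  have absw: "\<bar>\<Sum>v\<in>Y. w v\<bar> \<le> int (card Y)" for Y
  proof -
    have "\<bar>w v\<bar> = 1" for v using w(1)[of v] by auto
    then have "(\<Sum>v\<in>Y. \<bar>w v\<bar>) = int (card Y)" by simp
    then show ?thesis using sum_abs[of w Y] by simp
  qed
  \<comment> \<open>\<open>V\<close> has empty boundary, so the bounds \<open>b1\<close> and
    \<open>bM\<close> for \<open>V\<close> force the sums over \<open>V\<close> and \<open>T\<close>
    to vanish.\<close>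
  have w0: "(\<Sum>v\<in>V. w v) = 0" using b1[of V] bd_V[OF M1(1)] by simp
  have wT0: "(\<Sum>v\<in>T. w v) = 0" using bM[of V] bd_V[OF ME] w0 TV by (simp add: Int_absorb1)
  have cardE: "card (bd E X) = card (bd M1 X) + card (bd F X)" for X
  proof -
    have "bd E X = bd M1 X \<union> bd F X" "bd M1 X \<inter> bd F X = {}"
      using M1(1) by (auto simp: bd_def F_def)
    then show ?thesis using fin1 finF by (simp add: card_Un_disjoint bd_def)
  qed
  have cardM: "card (bd M X) \<le> card (bd F X)" for X
    using MF finF by (intro card_mono) (auto simp: bd_def)
  have open_case: "5 * \<bar>\<Sum>v\<in>X. w v\<bar> \<le> 3 * int (card (bd E X))"
    if X: "X \<subseteq> V" and no: "\<And>v. v \<in> X \<inter> T \<Longrightarrow> \<not> {y. (adj F)\<^sup>*\<^sup>* v y} \<subseteq> X" for X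
  proof -
    \<comment> \<open>With a boundary edges in \<open>M1\<close> and c in \<open>F\<close>, this
      yields |w(X)| \<le> a and 2 |w(X)| \<le> 3 c; three times the first bound plus the second is
      the claim.\<close>
    have "2 * card (X \<inter> T) \<le> card (bd F X)"
      using two_mult_card_le_card_bd[OF FE degF X, of "X \<inter> T"] no uniq by blast
    then show ?thesis
      using b1[OF X] bM[OF X] absw[of "X \<inter> T"] cardE[of X] cardM[of X] by linarith
  qed
  have "5 * \<bar>\<Sum>v\<in>X. w v\<bar> \<le> 3 * int (card (bd E X))" if X: "X \<subseteq> V" for X
  proof -
    have finX: "finite X" using X finite_V finite_subset by blast
    consider "\<And>v. v \<in> X \<inter> T \<Longrightarrow> \<not> {y. (adj F)\<^sup>*\<^sup>* v y} \<subseteq> X"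
      | "\<And>v. v \<in> (V - X) \<inter> T \<Longrightarrow> \<not> {y. (adj F)\<^sup>*\<^sup>* v y} \<subseteq> V - X"
      | u v where "u \<in> X" "v \<in> V - X" "{y. (adj F)\<^sup>*\<^sup>* u y} \<subseteq> X" "{y. (adj F)\<^sup>*\<^sup>* v y} \<subseteq> V - X"
      by blast
    then show ?thesis
    proof cases
      case 1
      then show ?thesis by (rule open_case[OF X])
    next
      case 2
      then have "5 * \<bar>\<Sum>v\<in>V - X. w v\<bar> \<le> 3 * int (card (bd E (V - X)))" by (intro open_case) auto
      moreover have "(\<Sum>v\<in>V - X. w v) = - (\<Sum>v\<in>X. w v)"
        using w0 sum.subset_diff[OF X finite_V, of w] by simp
      moreover have "bd E (V - X) = bd E X" using tail_in_V head_in_V by (auto simp: bd_def)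
      ultimately show ?thesis by simp
    next
      case 3
      then have n: "5 * card (M1 \<inter> M2) \<le> card (bd E X) + 3"
        using cyc[OF X] by (simp add: F_def)
      have "(\<Sum>v\<in>T. w v) = (\<Sum>v\<in>T - X. w v) + (\<Sum>v\<in>X \<inter> T. w v)"
        using sum.subset_diff[of "X \<inter> T" T w] finT by (simp add: Diff_Int)
      moreover have "card T = card (T - X) + card (X \<inter> T)"
        using card_Int_Diff[OF finT, of X] by (simp add: Int_commute)
      \<comment> \<open>As \<open>w\<close> sums to 0 over \<open>T\<close>, its sums over
        \<open>X \<inter> T\<close> and \<open>T - X\<close> agree in absolute value and are bounded
        by the smaller of the two sizes, at most half of \<open>card T\<close>.\<close>
      ultimately have tau: "\<bar>\<Sum>v\<in>X \<inter> T. w v\<bar> \<le> int (card (M1 \<inter> M2))"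
        using wT0 absw[of "X \<inter> T"] absw[of "T - X"] cardT by linarith
      \<comment> \<open>Both w(X) and, all degrees being 3, the size of the boundary have the parity
        of \<open>card X\<close>.\<close>
      have "even (\<Sum>v\<in>X. w v - 1)"
      proof (rule dvd_sum)
        fix v show "even (w v - 1)" using w(1)[of v] by auto
      qed
      moreover have "(\<Sum>v\<in>X. deg E v) = 3 * card X" using deg3 X by (simp add: subset_iff)
      then have "even (int (card X) - int (card (bd E X)))"
        using deg_sum_card[OF finite_E finX] by presburger
      ultimately have "even ((\<Sum>v\<in>X. w v) - int (card (bd E X)))"
        by (simp add: sum_subtractf)
      \<comment> \<open>Adding \<open>b1\<close> and \<open>bM\<close> gives 2 |w(X)| \<le> n +
        |\<tau>|, where n is the size of the boundary.\<close>
      then show ?thesis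
        using b1[OF X] bM[OF X] tau n cardE[of X] cardM[of X]
        by (intro balanced_if_large_cut[where g = "int (card (M1 \<inter> M2))"
              and \<tau> = "\<Sum>v\<in>X \<inter> T. w v"]) linarith+
    qed
  qed
  then show ?thesis using w(1) that by blast
qed

text \<open>In Jaeger's terms 5/3 times \<open>w\<close> is a balanced valuation. First
  \<open>w\<close> is realised as the net outdegree of an orientation; the same inequality then
  yields flow values for that orientation.\<close>

lemma five_flow:
  assumes w: "\<And>v. w v = 1 \<or> w v = (-1::int)"
    and deg3: "\<And>v. v \<in> V \<Longrightarrow> deg E v = 3"
    and bal: "\<And>X. X \<subseteq> V \<Longrightarrow> 5 * \<bar>\<Sum>v\<in>X. w v\<bar> \<le> 3 * int (card (bd E X))"
  shows "\<exists>(t' :: 'e \<Rightarrow> 'v) (h' :: 'e \<Rightarrow> 'v) (f :: 'e \<Rightarrow> nat).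
    (\<forall>e\<in>E. {#t e, h e#} = {#t' e, h' e#} \<and> f e \<in> {1..4}) \<and>
    (\<forall>v\<in>V. (\<Sum>e | e \<in> E \<and> h' e = v. f e) = (\<Sum>e | e \<in> E \<and> t' e = v. f e))"
proof -
  have "\<bar>\<Sum>v\<in>X. w v\<bar> \<le> int (card (bd E X))" if "X \<subseteq> V" for X using bal[OF that] by linarith
  then obtain t' h' where m: "multigraph V E t' h'"
    and ends: "\<And>e. e \<in> E \<Longrightarrow> {#t' e, h' e#} = {#t e, h e#}"
    and net: "\<And>v. v \<in> V \<Longrightarrow> multigraph.net E t' h' (\<lambda>_. 1) v = w v"
    using reorient[of w] w deg3 by metis
  interpret D: multigraph V E t' h' by (rule m)
  have "D.bd E X = bd E X" for X
    unfolding D.bd_def bd_def using ends by (intro Collect_cong conj_cong refl) (fastforce simp: add_eq_conv_ex)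
  moreover have "(\<Sum>v\<in>X. D.net (\<lambda>_. 1) v) = (\<Sum>v\<in>X. w v)" if "X \<subseteq> V" for X
    using that net by (intro sum.cong) auto
  ultimately obtain f where f: "\<forall>e\<in>E. 1 \<le> f e \<and> f e \<le> 4" "\<forall>v\<in>V. D.net f v = 0"
    using D.flow_1_4 bal by metis
  show ?thesis
  proof (rule exI[of _ t'], rule exI[of _ h'], rule exI[of _ "\<lambda>e. nat (f e)"], intro conjI ballI)
    show "{#t e, h e#} = {#t' e, h' e#}" if "e \<in> E" for e using ends[OF that] by simp
    show "nat (f e) \<in> {1..4}" if "e \<in> E" for e using f(1) that by auto
    have f_nat: "int (nat (f e)) = f e" if "e \<in> E" for e using f(1)[rule_format, OF that] by simp
    fix v assume v: "v \<in> V"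
    have "(\<Sum>e | e \<in> E \<and> t' e = v. f e) - (\<Sum>e | e \<in> E \<and> h' e = v. f e) =
        (\<Sum>e\<in>E. (if t' e = v then f e else 0) - (if h' e = v then f e else 0))"
      unfolding sum_subtractf by (simp add: sum.inter_filter[OF finite_E])
    also have "\<dots> = D.net f v" unfolding D.net_def by (intro sum.cong) auto
    also have "\<dots> = 0" using f(2) v by blast
    finally have "(\<Sum>e | e \<in> E \<and> h' e = v. f e) = (\<Sum>e | e \<in> E \<and> t' e = v. f e)" by simp
    moreover have "(\<Sum>e | e \<in> E \<and> P e. f e) = int (\<Sum>e | e \<in> E \<and> P e. nat (f e))" for P
      unfolding of_nat_sum by (rule sum.cong[OF refl]) (simp only: mem_Collect_eq f_nat)
    ultimately show "(\<Sum>e | e \<in> E \<and> h' e = v. nat (f e)) = (\<Sum>e | e \<in> E \<and> t' e = v. nat (f e))"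
      by (metis of_nat_eq_iff)
  qed
qed

end

section \<open>Graphs with a chosen orientation\<close>

text \<open>The orientation is an arbitrary reference that names the two ends of each edge; the
  direction of the flow is chosen later, in \<open>five_flow\<close>.\<close>

locale oriented_ugraph = multigraph "verts G" "edges G" t h
  for G :: "('v, 'e) ugraph" and t h +
  assumes ends_eq: "e \<in> edges G \<Longrightarrow> ends G e = {#t e, h e#}"
begin

lemma degree_eq: "F \<subseteq> edges G \<Longrightarrow> degree (G\<lparr>edges := F\<rparr>) v = deg F v"
  unfolding degree_def deg_def by (auto intro!: sum.cong simp: ends_eq subset_iff)

lemma edge_cut_bd:
  assumes "X \<noteq> {}" "X \<subset> verts G"
  shows "edge_cut G (bd (edges G) X)"
proof -
  have "e \<in> bd (edges G) X \<longleftrightarrow> (\<exists>u\<in>X. \<exists>v\<in>verts G - X. ends G e = {#u, v#})" if "e \<in> edges G" for e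
    using tail_in_V[OF that] head_in_V[OF that] that
    by (auto simp: bd_def ends_eq add_eq_conv_ex)
  then have "bd (edges G) X = {e \<in> edges G. \<exists>u\<in>X. \<exists>v\<in>verts G - X. ends G e = {#u, v#}}"
    by (auto simp: bd_def)
  with assms show ?thesis unfolding edge_cut_def by blast
qed

text \<open>The component of \<open>u\<close> in \<open>F\<close> is connected and 2-regular, hence
  a circuit. As \<open>D\<close> contains none of its edges, it survives inside the component of
  \<open>u\<close> after the deletion.\<close>

lemma component_contains_circuit:
  assumes F: "F \<subseteq> edges G" "\<And>v. v \<in> verts G \<Longrightarrow> deg F v = 2"
    and u: "u \<in> verts G" and D: "\<And>e. e \<in> F \<Longrightarrow> (adj F)\<^sup>*\<^sup>* u (t e) \<Longrightarrow> e \<notin> D"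
  shows "contains_circuit (induced_subgraph (delete_edges G D)
    {y \<in> verts G. (adjacent (delete_edges G D))\<^sup>*\<^sup>* u y})" (is "contains_circuit ?I")
proof -
  define K where "K = {y. (adj F)\<^sup>*\<^sup>* u y}"
  define FK where "FK = {e \<in> F. t e \<in> K}"
  define C where "C = \<lparr>verts = K, edges = FK, ends = ends G\<rparr>"
  have finF: "finite F" using F(1) finite_E finite_subset by blast
  have uK: "u \<in> K" by (simp add: K_def)
  have K_closed: "y \<in> K \<longleftrightarrow> z \<in> K" if "adj F y z" for y z
    using that sympD[OF symp_adj that] unfolding K_def
    by (auto intro: rtranclp.rtrancl_into_rtrancl)
  have K_ends: "t e \<in> K \<longleftrightarrow> h e \<in> K" if "e \<in> F" for e
    by (rule K_closed) (use that in \<open>auto simp: adj_def\<close>)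
  have C_adj: "adjacent C x y" "adjacent (delete_edges G D) x y" "y \<in> verts G"
    if xy: "adj F x y" "x \<in> K" for x y
  proof -
    obtain e where e: "e \<in> F" "t e = x \<and> h e = y \<or> t e = y \<and> h e = x"
      using xy(1) unfolding adj_def by blast
    then have tK: "t e \<in> K" using xy K_ends[OF e(1)] by auto
    have eE: "e \<in> edges G" using F(1) e(1) by blast
    have 1: "ends G e = {#x, y#}" using ends_eq[OF eE] e(2) by auto
    show "adjacent C x y" using 1 e(1) tK by (auto simp: adjacent_def C_def FK_def)
    show "adjacent (delete_edges G D) x y"
      using 1 eE D[OF e(1)] tK by (auto simp: adjacent_def delete_edges_def K_def)
    show "y \<in> verts G" using e(2) tail_in_V[OF eE] head_in_V[OF eE] by auto
  qed
  have reach: "(adjacent C)\<^sup>*\<^sup>* u x \<and> (adjacent (delete_edges G D))\<^sup>*\<^sup>* u x \<and> x \<in> verts G"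
    if "x \<in> K" for x
  proof -
    have "(adj F)\<^sup>*\<^sup>* u x" using that by (simp add: K_def)
    then show ?thesis
    proof (induction rule: rtranclp_induct)
      case base
      then show ?case using u by simp
    next
      case (step y z)
      then show ?case using C_adj[OF step.hyps(2)]
        by (auto simp: K_def intro: rtranclp.rtrancl_into_rtrancl)
    qed
  qed
  have finK: "finite K" by (rule finite_subset[OF _ finite_V]) (use reach in auto)
  have FKE: "FK \<subseteq> edges G" using F(1) by (auto simp: FK_def)
  have ends_K: "size (ends G e) = 2 \<and> set_mset (ends G e) \<subseteq> K" if "e \<in> FK" for e
    using that K_ends[of e] FKE ends_eq[of e] by (auto simp: FK_def)
  have fin: "finite_graph C"
    using finK finF ends_K by (auto simp: finite_graph_def C_def FK_def)
  have "subgraph C ?I"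
    unfolding subgraph_def using fin reach FKE ends_K D
    by (auto simp: C_def induced_subgraph_def delete_edges_def FK_def K_def)
  moreover have "circuit C"
  proof -
    have "symp (adjacent C)"
      by (auto simp: symp_def adjacent_def add_mset_commute)
    then have "(adjacent C)\<^sup>*\<^sup>* x y" if "x \<in> K" "y \<in> K" for x y
      using reach[OF that(1)] reach[OF that(2)] sympD[OF symp_rtranclp] by (metis rtranclp_trans)
    then have "connected_graph C" using uK by (auto simp: connected_graph_def C_def)
    moreover have "degree C v = 2" if "v \<in> K" for v
    proof -
      have "degree C v = deg FK v"
        using degree_eq[OF FKE, of v] by (simp add: degree_def C_def)
      moreover have "deg (F - FK) v = 0"
        using that K_ends finF by (subst deg_eq_0_iff) (auto simp: FK_def)
      moreover have "deg F v = deg FK v + deg (F - FK) v"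
        using finF by (intro deg_Diff) (auto simp: FK_def)
      ultimately show ?thesis using F(2)[of v] reach[OF that] by simp
    qed
    then have "regular 2 C" by (simp add: regular_def C_def)
    ultimately show ?thesis using fin by (simp add: circuit_def)
  qed
  ultimately show ?thesis unfolding contains_circuit_def by blast
qed

text \<open>The boundary of \<open>X\<close> separates the circuits of \<open>F\<close> through
  \<open>u\<close> and \<open>v\<close>, so it cannot have fewer than \<open>k\<close>
  edges.\<close>

lemma cyclic_cut:
  assumes cyc: "cyclically_edge_connected k G"
    and F: "F \<subseteq> edges G" "\<And>v. v \<in> verts G \<Longrightarrow> deg F v = 2"
    and X: "X \<subseteq> verts G" "u \<in> X" "v \<in> verts G - X"
    and Ku: "{y. (adj F)\<^sup>*\<^sup>* u y} \<subseteq> X" and Kv: "{y. (adj F)\<^sup>*\<^sup>* v y} \<subseteq> verts G - X"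
  shows "k \<le> card (bd (edges G) X)"
proof (rule ccontr)
  assume "\<not> ?thesis"
  then have less: "card (bd (edges G) X) < k" by simp
  let ?D = "bd (edges G) X"
  let ?H = "delete_edges G ?D"
  let ?I = "\<lambda>u. induced_subgraph ?H {y \<in> verts ?H. (adjacent ?H)\<^sup>*\<^sup>* u y}"
  have vH: "verts ?H = verts G" by (simp add: delete_edges_def)
  have inX: "e \<notin> ?D" if "e \<in> F" "(adj F)\<^sup>*\<^sup>* x (t e)" "{y. (adj F)\<^sup>*\<^sup>* x y} \<subseteq> Y"
    "Y = X \<or> Y = verts G - X" for e x Y
  proof -
    have "adj F (t e) (h e)" using that(1) by (auto simp: adj_def)
    with that(2) have "(adj F)\<^sup>*\<^sup>* x (h e)" by (rule rtranclp.rtrancl_into_rtrancl)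
    then show ?thesis using that by (auto simp: bd_def)
  qed
  have uV: "u \<in> verts G" and vV: "v \<in> verts G" using X by auto
  have "contains_circuit (?I u)" unfolding vH
    by (rule component_contains_circuit[OF F uV]) (use inX[OF _ _ Ku] in auto)
  moreover have "contains_circuit (?I v)" unfolding vH
    by (rule component_contains_circuit[OF F vV]) (use inX[OF _ _ Kv] in auto)
  moreover have "?I u \<in> components ?H" "?I v \<in> components ?H"
    using uV vV unfolding components_def vH by auto
  \<comment> \<open>Every remaining edge has both ends on the same side, so a walk from
    \<open>u\<close> never leaves \<open>X\<close>.\<close>
  moreover have "?I u \<noteq> ?I v"
  proof
    assume "?I u = ?I v"
    then have "verts (?I u) = verts (?I v)" by simp
    then have "(adjacent ?H)\<^sup>*\<^sup>* u v" using vV by (auto simp: induced_subgraph_def vH)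
    then have "v \<in> X"
    proof (induction rule: rtranclp_induct)
      case base
      then show ?case using X by simp
    next
      case (step y z)
      then obtain e where "e \<in> edges G" "e \<notin> ?D" "ends G e = {#y, z#}"
        by (auto simp: adjacent_def delete_edges_def)
      then show ?case using step.IH ends_eq[of e] by (auto simp: bd_def add_eq_conv_ex)
    qed
    then show False using X by simp
  qed
  moreover have "edge_cut G ?D" using X by (intro edge_cut_bd) auto
  ultimately show False using cyc less unfolding cyclically_edge_connected_def by blast
qed

end

section \<open>Passage from finite graphs to oriented ones, and the conclusion\<close>

lemma finite_graph_orientation:
  assumes "finite_graph G"
  obtains t h where "oriented_ugraph G t h"
proof -
  have "\<exists>x y. ends G e = {#x, y#}" if "e \<in> edges G" for e
  proof -
    have "size (ends G e) = Suc (Suc 0)" using assms that by (simp add: finite_graph_def)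
    moreover from this obtain x N where N: "ends G e = add_mset x N"
      using size_eq_Suc_imp_eq_union by blast
    ultimately have "size N = 1" by simp
    then obtain y where "N = {#y#}" using size_1_singleton_mset by blast
    with N show ?thesis by blast
  qed
  then obtain t h where th: "\<And>e. e \<in> edges G \<Longrightarrow> ends G e = {#t e, h e#}" by metis
  have "set_mset (ends G e) \<subseteq> verts G" if "e \<in> edges G" for e
    using assms that by (simp add: finite_graph_def)
  then have "t e \<in> verts G \<and> h e \<in> verts G" if "e \<in> edges G" for e
    using that th[OF that] by fastforce
  then have "oriented_ugraph G t h"
    by unfold_locales (use assms th in \<open>auto simp: finite_graph_def\<close>)
  then show ?thesis using that by blast
qed

text \<open>In \<open>enat\<close> the infimum of a nonempty set is its least element and that of
  the empty set is \<open>\<infinity>\<close>, so finiteness yields 1-factors.\<close>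

lemma mu2_attained:
  assumes "mu2 G \<noteq> \<infinity>"
  obtains M1 M2 where "one_factor G M1" "one_factor G M2" "mu2 G = enat (card (M1 \<inter> M2))"
proof -
  let ?S = "{enat (card (M1 \<inter> M2)) | M1 M2. one_factor G M1 \<and> one_factor G M2}"
  have Inf_in: "Inf S \<in> S" if "S \<noteq> {}" for S :: "enat set"
    using that unfolding Inf_enat_def by (auto intro: LeastI)
  have "?S \<noteq> {}"
  proof
    assume "?S = {}"
    then have "mu2 G = \<infinity>" unfolding mu2_def by (simp only: Inf_enat_def) simp
    then show False using assms by simp
  qed
  then have "mu2 G \<in> ?S" unfolding mu2_def by (rule Inf_in)
  then show ?thesis using that by blast
qed

theorem theorem1p3:
  fixes G :: "('v, 'e) ugraph" and k :: nat
  assumes "k > 0"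
    and "finite_graph G"
    and "cubic G"
    and "bridgeless G"
    and "cyclically_edge_connected k G"
    and "enat k + 3 \<ge> 5 * mu2 G"
  shows "has_nowhere_zero_flow 5 G"
proof -
  obtain t h where "oriented_ugraph G t h"
    using finite_graph_orientation[OF assms(2)] by blast
  then interpret oriented_ugraph G t h .
  \<comment> \<open>Otherwise \<open>5 * mu2 G\<close> would exceed the finite number
    \<open>enat k + 3\<close>.\<close>
  have "mu2 G \<noteq> \<infinity>"
    using assms(6) by (cases "mu2 G") (auto simp: numeral_eq_enat)
  then obtain M1 M2 where M: "one_factor G M1" "one_factor G M2"
    and mu: "mu2 G = enat (card (M1 \<inter> M2))" by (rule mu2_attained)
  have k: "5 * card (M1 \<inter> M2) \<le> k + 3"
    using assms(6) by (simp add: mu numeral_eq_enat)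
  have deg3: "deg (edges G) v = 3" if "v \<in> verts G" for v
    using assms(3) that degree_eq[of "edges G" v] by (simp add: cubic_def regular_def)
  have M': "M1 \<subseteq> edges G" "M2 \<subseteq> edges G"
    "v \<in> verts G \<Longrightarrow> deg M1 v = 1" "v \<in> verts G \<Longrightarrow> deg M2 v = 1" for v
    using M degree_eq[of M1 v] degree_eq[of M2 v] by (auto simp: one_factor_def regular_def)
  have F: "deg (edges G - M1) v = 2" if "v \<in> verts G" for v
    using deg_Diff[OF finite_E M'(1), of v] deg3[OF that] M'(3)[OF that] by simp
  have "5 * card (M1 \<inter> M2) \<le> card (bd (edges G) X) + 3"
    if "X \<subseteq> verts G" "u \<in> X" "v \<in> verts G - X" "{y. (adj (edges G - M1))\<^sup>*\<^sup>* u y} \<subseteq> X"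
      "{y. (adj (edges G - M1))\<^sup>*\<^sup>* v y} \<subseteq> verts G - X" for X u v
    using cyclic_cut[OF assms(5) Diff_subset F that] k by linarith
  then obtain w where w: "\<And>v. w v = 1 \<or> w v = (-1::int)"
    "\<And>X. X \<subseteq> verts G \<Longrightarrow> 5 * \<bar>\<Sum>v\<in>X. w v\<bar> \<le> 3 * int (card (bd (edges G) X))"
    using balanced_valuation_exists[OF deg3 M'(1,3,2,4)] by metis
  have "\<exists>t' h' (f :: 'e \<Rightarrow> nat).
      (\<forall>e\<in>edges G. {#t e, h e#} = {#t' e, h' e#} \<and> f e \<in> {1..4}) \<and>
      (\<forall>v\<in>verts G. (\<Sum>e | e \<in> edges G \<and> h' e = v. f e) = (\<Sum>e | e \<in> edges G \<and> t' e = v. f e))"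
    by (rule five_flow[OF w(1) deg3 w(2)])
  then show ?thesis unfolding has_nowhere_zero_flow_def by (simp add: ends_eq)
qed

end
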